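(* Let $G:=\mathrm{GL}_3(\mathbb C)$ act by conjugation on $X:=\mathfrak{sl}_3(\mathbb C)\setminus\{0\}$, let $e:=E_{12}$, $f:=E_{21}$, and let $\mathfrak s_{\mathbb C}:=e+\mathfrak{sl}_3(\mathbb C)^f=\left\{\begin{pmatrix} a&1&0\\ b&a&c\\ d&0&-2a\end{pmatrix}: a,b,c,d\in\mathbb C\right\}$. Then $\mathfrak s_{\mathbb C}$ is a slice to the action of $G$ at $e$, and for every $y\in\mathfrak s_{\mathbb C}$ the Nash manifold $\{g\in G\mid gyg^{-1}\in\mathfrak s_{\mathbb C}\}$ is connected.
   Context: $E_{ij}$ denotes the elementary matrix, and $\mathfrak{sl}_3(\mathbb C)^f$ the centralizer of $f$ in $\mathfrak{sl}_3(\mathbb C)$. A slice to the action of $G$ at $x$ is a locally closed Nash submanifold $S\subset X$ with $x\in S$ such that the action map $a:G\times S\to X$ is a submersion and $\dim(Gx)+\dim S=\dim X$ (real dimensions). *)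

theory Defs
  imports "HOL-Analysis.Analysis"
begin

type_synonym cmat = "complex^3^3"

text \<open>The group G = GL_3(C), as invertible complex 3x3 matrices.\<close>
definition GL3 :: "cmat set" where
  "GL3 = {g. invertible g}"

text \<open>sl_3(C): trace-zero complex 3x3 matrices.\<close>
definition sl3 :: "cmat set" where
  "sl3 = {A. trace A = 0}"

text \<open>X = sl_3(C) minus 0.\<close>
definition Xsl3 :: "cmat set" where
  "Xsl3 = sl3 - {0}"

text \<open>Conjugation action g . y = g y g^-1.\<close>
definition conj_act :: "cmat \<Rightarrow> cmat \<Rightarrow> cmat" where
  "conj_act g y = g ** y ** matrix_inv g"

text \<open>Elementary matrix E_ij.\<close>
definition Emat :: "3 \<Rightarrow> 3 \<Rightarrow> cmat" where
  "Emat i j = (\<chi> r c. if r = i \<and> c = j then 1 else 0)"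

definition e_mat :: cmat where "e_mat = Emat 1 2"
definition f_mat :: cmat where "f_mat = Emat 2 1"

text \<open>Centralizer of f in sl_3(C).\<close>
definition centralizer_sl3 :: "cmat \<Rightarrow> cmat set" where
  "centralizer_sl3 z = {y \<in> sl3. y ** z = z ** y}"

text \<open>The slice s_C = e + sl_3(C)^f.\<close>
definition sC :: "cmat set" where
  "sC = (\<lambda>y. e_mat + y) ` centralizer_sl3 f_mat"

text \<open>Slice to the conjugation action of GL_3(C) on X at x, for S an affine
  (hence Nash) submanifold; real dimensions; the tangent space of S at s is
  the direction space {v - s | v in S}; the tangent space of X is sl_3; the
  tangent space of the orbit G x at x is the image of the differential at the
  identity of the orbit map g |-> g x g^-1.\<close>
definition is_affine_slice :: "cmat \<Rightarrow> cmat set \<Rightarrow> bool" where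
  "is_affine_slice x S \<longleftrightarrow>
     affine S \<and> S \<subseteq> Xsl3 \<and> x \<in> S \<and>
     (\<exists>U. open U \<and> S = U \<inter> closure S) \<and>
     (\<forall>g\<in>GL3. \<forall>s\<in>S. \<exists>D.
        ((\<lambda>p. conj_act (fst p) (snd p)) has_derivative D) (at (g, s)) \<and>
        D ` (UNIV \<times> ((\<lambda>v. v - s) ` S)) = sl3) \<and>
     (\<exists>Do. ((\<lambda>g. conj_act g x) has_derivative Do) (at (mat 1)) \<and>
        dim (range Do) + dim ((\<lambda>v. v - x) ` S) = dim sl3)"

end

theory Submission
  imports Defs "HOL-Computational_Algebra.Polynomial"
begin

(* The slice property is a tangent space computation: at every point s of the slice the
   commutators [h, s] together with the direction space of the slice span sl_3, and at e the
   orbit and the slice have real dimensions 8 + 8 = 16.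

   For connectedness write k = g^-1 with columns (k1, v, w).  Then g y g^-1 lies in the slice
   iff y v = k1 + a v and y w = c v - 2a w for some a, c.  Such frames are recovered
   continuously from the pairs (v, z) with det (v, y v, z) <> 0: w is z corrected by a multiple
   of v, after which k1 and a are forced.  These pairs form the complement of a complex
   hypersurface in C^6, which is connected because every point lies on a complex line through a
   fixed base point meeting the hypersurface in finitely many points. *)

section \<open>Matrices and the inverse map\<close>

lemma matrix_inv_inverse:
  fixes A :: "'a::semiring_1^'n^'n"
  assumes "invertible A"
  shows "A ** matrix_inv A = mat 1" and "matrix_inv A ** A = mat 1"
  using someI_ex[OF assms[unfolded invertible_def]] unfolding matrix_inv_def by auto

lemma matrix_inv_unique:
  fixes A B :: "'a::field^'n^'n"
  assumes "A ** B = mat 1"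
  shows "matrix_inv A = B"
proof -
  have "B ** A = mat 1"
    using assms matrix_left_right_inverse by blast
  then have "invertible A"
    using assms invertible_def by blast
  then have "matrix_inv A = matrix_inv A ** (A ** B)"
    using assms by simp
  also have "\<dots> = B"
    by (simp add: matrix_mul_assoc matrix_inv_inverse \<open>invertible A\<close>)
  finally show ?thesis .
qed

lemma invertible_matrix_inv:
  fixes A :: "'a::field^'n^'n"
  assumes "invertible A"
  shows "invertible (matrix_inv A)" and "matrix_inv (matrix_inv A) = A"
  using matrix_inv_inverse[OF assms] invertible_def matrix_inv_unique by blast+

lemma matrix_inv_mat_1: "matrix_inv (mat 1 :: 'a::field^'n^'n) = mat 1"
  by (rule matrix_inv_unique) simp

lemma matrix_mult_ring_distribs:
  fixes A B C :: "'a::ring_1^'n^'n"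
  shows matrix_mult_right_diff_distrib: "A ** (B - C) = A ** B - A ** C"
    and matrix_mult_left_diff_distrib: "(B - C) ** A = B ** A - C ** A"
    and matrix_mult_left_distrib: "(B + C) ** A = B ** A + C ** A"
    and matrix_mult_minus_right: "A ** (- B) = - (A ** B)"
  by (simp_all add: matrix_matrix_mult_def vec_eq_iff algebra_simps sum_subtractf sum.distrib
      sum_negf)

lemma mat_nth: "mat c $ i $ j = (if i = j then c else 0)"
  by (simp add: mat_def)

lemma matrix_mult_mat_nth:
  fixes A :: "'a::semiring_1^'n^'n"
  shows "(mat c ** A) $ i $ j = c * A $ i $ j" and "(A ** mat c) $ i $ j = A $ i $ j * c"
  by (simp_all add: matrix_matrix_mult_def mat_nth if_distrib[of "\<lambda>x. x * _"]
      if_distrib[of "\<lambda>x. _ * x"] cong: if_cong)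

lemma mat_matrix_mult_commute:
  fixes A :: "'a::comm_semiring_1^'n^'n"
  shows "mat c ** A = A ** mat c"
  unfolding vec_eq_iff matrix_mult_mat_nth by (simp add: mult.commute)

lemma mat_mult_mat: "mat a ** mat b = (mat (a * b) :: 'a::semiring_1^'n^'n)"
  by (simp add: vec_eq_iff matrix_mult_mat_nth(1) mat_nth)

lemma trace_conj:
  fixes A :: "'a::comm_semiring_1^'n^'n"
  assumes "B ** A = mat 1"
  shows "trace (A ** W ** B) = trace W"
proof -
  have "trace (A ** W ** B) = trace (B ** (A ** W))"
    by (rule trace_mul_sym)
  also have "B ** (A ** W) = W"
    by (simp add: matrix_mul_assoc assms)
  finally show ?thesis .
qed

lemma matrix_vector_mult_cancel:
  assumes "invertible (A::'a::field^'n^'n)"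
  shows "A *v x = A *v x' \<longleftrightarrow> x = x'"
  by (metis assms matrix_inv_inverse(2) matrix_vector_mul_assoc matrix_vector_mul_lid)

lemma bounded_bilinear_matrix_matrix_mult:
  "bounded_bilinear
    ((**) :: 'a::{euclidean_space,real_normed_algebra_1}^'n^'m \<Rightarrow> 'a^'p^'n \<Rightarrow> 'a^'p^'m)"
  unfolding bilinear_conv_bounded_bilinear[symmetric] bilinear_def linear_iff
  by (simp add: matrix_matrix_mult_def vec_eq_iff algebra_simps sum.distrib scaleR_sum_right)

lemmas has_derivative_matrix_mult[derivative_intros] =
  bounded_bilinear.FDERIV[OF bounded_bilinear_matrix_matrix_mult]

lemma has_derivative_vec_nth[derivative_intros]:
  "(f has_derivative f') F \<Longrightarrow> ((\<lambda>x. f x $ i) has_derivative (\<lambda>h. f' h $ i)) F"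
  by (rule bounded_linear.has_derivative[OF bounded_linear_vec_nth])

lemma bounded_linear_mat: "bounded_linear (mat :: 'a::euclidean_space \<Rightarrow> 'a^'n^'n)"
  unfolding linear_conv_bounded_linear[symmetric] linear_iff
  by (simp add: mat_def vec_eq_iff)

lemmas has_derivative_mat[derivative_intros] = bounded_linear.has_derivative[OF bounded_linear_mat]

lemma continuous_on_det[continuous_intros]:
  fixes f :: "'b::topological_space \<Rightarrow> 'a::real_normed_field^'n^'n"
  shows "continuous_on S f \<Longrightarrow> continuous_on S (\<lambda>x. det (f x))"
  unfolding det_def by (intro continuous_intros continuous_on_component)

lemma differentiable_det:
  "(det :: 'a::real_normed_field^'n^'n \<Rightarrow> 'a) differentiable (at A)"
  unfolding differentiable_def det_def[abs_def]
  by (rule exI has_derivative_sum has_derivative_mult has_derivative_const has_derivative_prod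
      has_derivative_vec_nth has_derivative_ident)+

lemma open_nonsingular: "open {A::'a::real_normed_field^'n^'n. det A \<noteq> 0}"
  by (intro open_Collect_neq continuous_on_det continuous_on_id continuous_on_const)

lemma continuous_on_vector_scalar_mult [continuous_intros]:
  fixes g :: "'a::topological_space \<Rightarrow> 'b::real_normed_field^'n"
  assumes "continuous_on S f" "continuous_on S g"
  shows "continuous_on S (\<lambda>x. f x *s g x)"
  unfolding vector_scalar_mult_def
  by (intro continuous_on_vec_lambda continuous_on_mult continuous_on_component assms)

lemma continuous_on_matrix_vector_mult [continuous_intros]:
  fixes A :: "'b::real_normed_field^'n^'m"
  shows "continuous_on S f \<Longrightarrow> continuous_on S (\<lambda>x. A *v f x)"
  unfolding matrix_vector_mult_def
  by (intro continuous_intros continuous_on_vec_lambda continuous_on_component)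

text \<open>By Cayley--Hamilton, \<open>X\<^sup>3 - tr X X\<^sup>2 + ((tr X)\<^sup>2 - tr X\<^sup>2)/2 X = det X\<close> for 3x3 matrices,
  so this is the adjugate of \<open>X\<close>.\<close>
definition adjugate3 :: "cmat \<Rightarrow> cmat" where
  "adjugate3 X = X ** X - mat (trace X) ** X + mat ((trace X ^ 2 - trace (X ** X)) / 2)"

lemma matrix_mult_adjugate3: "X ** adjugate3 X = mat (det X)"
  by (simp add: adjugate3_def det_3 trace_def sum_3 matrix_matrix_mult_def vec_eq_iff forall_3
      mat_def field_simps power2_eq_square)

lemma matrix_inv_adjugate3:
  assumes "det X \<noteq> 0"
  shows "matrix_inv X = mat (inverse (det X)) ** adjugate3 X"
proof (rule matrix_inv_unique)
  have "X ** (mat (inverse (det X)) ** adjugate3 X) = mat (inverse (det X) * det X)"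
    by (metis matrix_mul_assoc mat_matrix_mult_commute matrix_mult_adjugate3 mat_mult_mat)
  then show "X ** (mat (inverse (det X)) ** adjugate3 X) = mat 1"
    using assms by simp
qed

lemma differentiable_adjugate3: "adjugate3 differentiable (at A)"
  unfolding differentiable_def adjugate3_def[abs_def] trace_def
  by (rule exI has_derivative_add has_derivative_diff has_derivative_matrix_mult has_derivative_mat
      has_derivative_divide' has_derivative_power has_derivative_sum has_derivative_vec_nth
      has_derivative_const has_derivative_ident)+ simp

lemma has_derivative_matrix_inv:
  assumes "invertible (A::cmat)"
  shows "(matrix_inv has_derivative (\<lambda>H. - (matrix_inv A ** H ** matrix_inv A))) (at A)"
proof -
  have detA: "det A \<noteq> 0"
    using assms invertible_det_nz by blast
  obtain Dd Da where Dd: "(det has_derivative Dd) (at A)"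
    and Da: "(adjugate3 has_derivative Da) (at A)"
    using differentiable_det differentiable_adjugate3 unfolding differentiable_def by blast
  obtain D where D: "(matrix_inv has_derivative D) (at A)"
    using has_derivative_transform_within_open[OF has_derivative_matrix_mult[OF
        has_derivative_mat[OF Deriv.has_derivative_inverse[OF detA Dd]] Da] open_nonsingular,
        of matrix_inv]
      detA matrix_inv_adjugate3 by auto
  \<comment> \<open>\<open>D\<close> is forced by differentiating \<open>X ** matrix_inv X = mat 1\<close> at \<open>A\<close>\<close>
  have "((\<lambda>X. X ** matrix_inv X) has_derivative (\<lambda>H. A ** D H + H ** matrix_inv A)) (at A)"
    using has_derivative_matrix_mult[OF has_derivative_ident D] by simp
  moreover have "((\<lambda>X. X ** matrix_inv X) has_derivative (\<lambda>H. 0)) (at A)"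
    by (rule has_derivative_transform_within_open[OF has_derivative_const[of "mat 1"]
          open_nonsingular])
      (auto simp: detA invertible_det_nz matrix_inv_inverse)
  ultimately have "(\<lambda>H. A ** D H + H ** matrix_inv A) = (\<lambda>H. 0)"
    by (rule has_derivative_unique)
  then have "A ** D H + H ** matrix_inv A = 0" for H
    by (meson fun_cong)
  then have "D H = matrix_inv A ** (A ** D H)" and "A ** D H = - (H ** matrix_inv A)" for H
    by (simp_all add: matrix_mul_assoc matrix_inv_inverse assms eq_neg_iff_add_eq_0)
  then have "D = (\<lambda>H. - (matrix_inv A ** H ** matrix_inv A))"
    by (simp add: fun_eq_iff matrix_mult_minus_right matrix_mul_assoc)
  with D show ?thesis
    by simp
qed

lemma continuous_on_matrix_inv: "continuous_on {A::cmat. invertible A} matrix_inv"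
  by (rule continuous_at_imp_continuous_on)
    (auto intro: has_derivative_continuous has_derivative_matrix_inv)

section \<open>Complements of polynomial hypersurfaces\<close>

definition is_polynomial :: "('a::comm_ring_1 \<Rightarrow> 'a) \<Rightarrow> bool" where
  "is_polynomial f \<longleftrightarrow> (\<exists>p. \<forall>t. f t = poly p t)"

lemma is_polynomial_const: "is_polynomial (\<lambda>t. c)"
  unfolding is_polynomial_def by (intro exI[of _ "[:c:]"]) simp

lemma is_polynomial_ident: "is_polynomial (\<lambda>t. t)"
  unfolding is_polynomial_def by (intro exI[of _ "[:0, 1:]"]) simp

lemma is_polynomial_add: "is_polynomial f \<Longrightarrow> is_polynomial g \<Longrightarrow> is_polynomial (\<lambda>t. f t + g t)"
  unfolding is_polynomial_def by (metis poly_add)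

lemma is_polynomial_diff: "is_polynomial f \<Longrightarrow> is_polynomial g \<Longrightarrow> is_polynomial (\<lambda>t. f t - g t)"
  unfolding is_polynomial_def by (metis poly_diff)

lemma is_polynomial_mult: "is_polynomial f \<Longrightarrow> is_polynomial g \<Longrightarrow> is_polynomial (\<lambda>t. f t * g t)"
  unfolding is_polynomial_def by (metis poly_mult)

lemmas is_polynomial_intros = is_polynomial_const is_polynomial_ident is_polynomial_add
  is_polynomial_diff is_polynomial_mult

text \<open>Each \<open>x\<close> lies on a complex line through \<open>a\<close> that meets the zero set of \<open>f\<close> in finitely
  many points, and a punctured complex line is connected.\<close>
lemma connected_nonzero_set_if_polynomial_on_lines:
  fixes f :: "'a::topological_space \<Rightarrow> complex"
  assumes "f a \<noteq> 0"
    and lines: "\<And>x. \<exists>\<gamma>. continuous_on UNIV \<gamma> \<and> \<gamma> 0 = a \<and> \<gamma> 1 = x \<and> is_polynomial (\<lambda>t. f (\<gamma> t))"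
  shows "connected {x. f x \<noteq> 0}"
proof -
  define \<C> where "\<C> = {C. connected C \<and> a \<in> C \<and> C \<subseteq> {x. f x \<noteq> 0}}"
  have "\<exists>C\<in>\<C>. x \<in> C" if "f x \<noteq> 0" for x
  proof -
    obtain \<gamma> p where \<gamma>: "continuous_on UNIV \<gamma>" "\<gamma> 0 = a" "\<gamma> 1 = x"
      and p: "\<And>t. f (\<gamma> t) = poly p t"
      using lines[of x] unfolding is_polynomial_def by blast
    have "poly p 0 \<noteq> 0" "poly p 1 \<noteq> 0"
      using p[of 0] p[of 1] \<gamma>(2,3) \<open>f a \<noteq> 0\<close> \<open>f x \<noteq> 0\<close> by simp_all
    have "a \<in> \<gamma> ` (- {t. poly p t = 0})" "x \<in> \<gamma> ` (- {t. poly p t = 0})"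
      using \<open>poly p 0 \<noteq> 0\<close> \<open>poly p 1 \<noteq> 0\<close> \<gamma>(2,3)
      by (intro image_eqI[of _ \<gamma> 0] image_eqI[of _ \<gamma> 1]; simp)+
    have "p \<noteq> 0"
      using \<open>poly p 0 \<noteq> 0\<close> by auto
    then have "countable {t. poly p t = 0}"
      by (simp add: poly_roots_finite countable_finite)
    then have "connected (- {t. poly p t = 0})"
      by (simp add: path_connected_complement_countable path_connected_imp_connected)
    then have "connected (\<gamma> ` (- {t. poly p t = 0}))"
      by (rule connected_continuous_image[OF continuous_on_subset[OF \<gamma>(1)], rotated]) simp
    moreover note \<open>a \<in> \<gamma> ` (- {t. poly p t = 0})\<close> \<open>x \<in> \<gamma> ` (- {t. poly p t = 0})\<close>
    moreover have "\<gamma> ` (- {t. poly p t = 0}) \<subseteq> {x. f x \<noteq> 0}"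
      using p by auto
    ultimately show ?thesis
      by (intro bexI[of _ "\<gamma> ` (- {t. poly p t = 0})"]) (simp_all add: \<C>_def)
  qed
  then have "{x. f x \<noteq> 0} \<subseteq> \<Union>\<C>"
    by blast
  moreover have "\<Union>\<C> \<subseteq> {x. f x \<noteq> 0}" and "connected (\<Union>\<C>)"
    by (auto simp: \<C>_def intro!: connected_Union)
  ultimately show ?thesis
    by (simp add: subset_antisym)
qed

section \<open>The slice\<close>

lemma mem_sC_iff:
  "M \<in> sC \<longleftrightarrow> M$1$2 = 1 \<and> M$1$3 = 0 \<and> M$2$2 = M$1$1 \<and> M$3$2 = 0 \<and> M$3$3 = -2 * M$1$1"
proof -
  have "M \<in> sC \<longleftrightarrow> M - e_mat \<in> centralizer_sl3 f_mat"
    unfolding sC_def by (auto simp: image_iff intro!: bexI[of _ "M - e_mat"])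
  also have "\<dots> \<longleftrightarrow> M$1$2 = 1 \<and> M$1$3 = 0 \<and> M$2$2 = M$1$1 \<and> M$3$2 = 0 \<and> M$3$3 = -2 * M$1$1"
    by (simp add: centralizer_sl3_def sl3_def trace_def sum_3 matrix_matrix_mult_def vec_eq_iff
        forall_3 f_mat_def e_mat_def Emat_def) (auto simp: algebra_simps eq_neg_iff_add_eq_0)
  finally show ?thesis .
qed

lemma sC_eq_matrices:
  "sC = {vector [vector [a, 1, 0], vector [b, a, c], vector [d, 0, -2 * a]] | a b c d. True}"
proof (intro set_eqI iffI)
  fix M assume "M \<in> sC"
  then have "M = vector [vector [M$1$1, 1, 0], vector [M$2$1, M$1$1, M$2$3], vector [M$3$1, 0, -2 * M$1$1]]"
    by (simp add: mem_sC_iff vec_eq_iff forall_3)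
  then show "M \<in> {vector [vector [a, 1, 0], vector [b, a, c], vector [d, 0, -2 * a]] | a b c d. True}"
    by blast
qed (auto simp: mem_sC_iff)

lemma trace_sC: "s \<in> sC \<Longrightarrow> trace s = 0"
  by (simp add: mem_sC_iff trace_def sum_3)

lemma sC_subset_Xsl3: "sC \<subseteq> Xsl3"
  by (auto simp: Xsl3_def sl3_def trace_sC mem_sC_iff)

lemma e_mat_in_sC: "e_mat \<in> sC"
  by (simp add: mem_sC_iff e_mat_def Emat_def)

lemma affine_sC: "affine sC"
  unfolding affine_def
proof (intro ballI allI impI)
  fix x y :: cmat and u v :: real
  assume "x \<in> sC" "y \<in> sC" "u + v = 1"
  moreover have "r *\<^sub>R z = complex_of_real r * z" for r and z :: complex
    by (simp add: scaleR_conv_of_real)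
  ultimately show "u *\<^sub>R x + v *\<^sub>R y \<in> sC"
    by (simp add: mem_sC_iff algebra_simps flip: distrib_right of_real_add)
qed

text \<open>\<open>h\<close> is supported on the first column and the entry \<open>(2,3)\<close>; its commutator with \<open>s\<close>
  matches the entries \<open>(1,2)\<close>, \<open>(1,3)\<close>, \<open>(3,2)\<close> and \<open>(2,2) - (1,1)\<close> of \<open>w\<close>, which are constant
  along the slice.\<close>
lemma sl3_eq_commutator_plus_slice_direction:
  assumes "s \<in> sC" and "trace w = 0"
  shows "\<exists>h N. h ** s - s ** h + N = w \<and> s + N \<in> sC"
proof -
  have s: "s$1$2 = 1" "s$1$3 = 0" "s$2$2 = s$1$1" "s$3$2 = 0" "s$3$3 = -2 * s$1$1"
    using assms(1) by (simp_all add: mem_sC_iff)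
  have w33: "w$3$3 = - w$1$1 - w$2$2"
    using assms(2) by (simp add: trace_def sum_3 algebra_simps eq_neg_iff_add_eq_0)
  define m where "m = (w$1$1 + w$2$2) / 2"
  define h :: cmat where "h = vector [vector [w$1$2, 0, 0], vector [(w$2$2 - w$1$1) / 2, 0, - w$1$3],
      vector [w$3$2, 0, 0]]"
  define N :: cmat where "N = vector [vector [m, 0, 0],
      vector [w$2$1 + s$3$1 * w$1$3 + s$2$1 * w$1$2 + s$2$3 * w$3$2, m, w$2$3 - 3 * s$1$1 * w$1$3],
      vector [w$3$1 - 3 * s$1$1 * w$3$2 + s$3$1 * w$1$2, 0, -2 * m]]"
  have "h ** s - s ** h + N = w"
    using s by (simp add: h_def N_def m_def matrix_matrix_mult_def vec_eq_iff forall_3 sum_3 w33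
        field_simps)
  moreover have "s + N \<in> sC"
    using s by (simp add: mem_sC_iff N_def m_def algebra_simps)
  ultimately show ?thesis
    by blast
qed

lemma has_derivative_conj_act:
  assumes "invertible g"
  shows "((\<lambda>p. conj_act (fst p) (snd p)) has_derivative
      (\<lambda>(h, v). g ** (matrix_inv g ** h ** s - s ** (matrix_inv g ** h) + v) ** matrix_inv g)) (at (g, s))"
proof -
  have "((\<lambda>p. fst p ** snd p) has_derivative (\<lambda>q. fst (g, s) ** snd q + fst q ** snd (g, s))) (at (g, s))"
    by (intro has_derivative_matrix_mult has_derivative_fst has_derivative_snd has_derivative_ident)
  moreover have "((\<lambda>p. matrix_inv (fst p)) has_derivative
      (\<lambda>q. - (matrix_inv g ** fst q ** matrix_inv g))) (at (g, s))"
    using has_derivative_compose[OF has_derivative_fst[OF has_derivative_ident]]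
      has_derivative_matrix_inv[OF assms] by fastforce
  ultimately have "((\<lambda>p. conj_act (fst p) (snd p)) has_derivative
      (\<lambda>q. g ** s ** (- (matrix_inv g ** fst q ** matrix_inv g)) + (g ** snd q + fst q ** s) ** matrix_inv g))
      (at (g, s))"
    unfolding conj_act_def by (auto dest: has_derivative_matrix_mult)
  then show ?thesis
    by (rule has_derivative_eq_rhs)
      (simp add: fun_eq_iff matrix_mult_ring_distribs matrix_add_ldistrib matrix_mul_assoc
        matrix_inv_inverse assms)
qed

lemma conj_act_derivative_image:
  assumes g: "invertible g" and s: "s \<in> sC"
  shows "(\<lambda>(h, v). g ** (matrix_inv g ** h ** s - s ** (matrix_inv g ** h) + v) ** matrix_inv g)
      ` (UNIV \<times> (\<lambda>v. v - s) ` sC) = sl3"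
    (is "?D ` ?T = _")
proof (intro equalityI subsetI)
  fix x assume "x \<in> ?D ` ?T"
  then obtain h s' where "s' \<in> sC" and x: "x = ?D (h, s' - s)"
    by auto
  then have "trace x = trace (matrix_inv g ** h ** s - s ** (matrix_inv g ** h)) + trace s' - trace s"
    by (simp add: trace_conj matrix_inv_inverse g trace_add trace_sub)
  also have "\<dots> = 0"
    using \<open>s' \<in> sC\<close> s by (simp add: trace_sub trace_mul_sym[of _ s] trace_sC matrix_mul_assoc)
  finally show "x \<in> sl3"
    by (simp add: sl3_def)
next
  fix x assume "x \<in> sl3"
  then have "trace (matrix_inv g ** x ** g) = 0"
    by (simp add: trace_conj matrix_inv_inverse g sl3_def)
  then obtain h N where hN: "h ** s - s ** h + N = matrix_inv g ** x ** g" and "s + N \<in> sC"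
    using sl3_eq_commutator_plus_slice_direction[OF s] by blast
  have "matrix_inv g ** (g ** h) = h"
    by (simp add: matrix_mul_assoc matrix_inv_inverse g)
  then have "?D (g ** h, N) = g ** (matrix_inv g ** x ** g) ** matrix_inv g"
    by (simp only: hN case_prod_conv)
  also have "\<dots> = x"
    by (metis matrix_mul_assoc matrix_mul_lid matrix_mul_rid matrix_inv_inverse g)
  finally have "x = ?D (g ** h, (s + N) - s)"
    by simp
  with \<open>s + N \<in> sC\<close> show "x \<in> ?D ` ?T"
    by blast
qed

lemma has_derivative_orbit_map:
  "((\<lambda>g. conj_act g x) has_derivative (\<lambda>h. h ** x - x ** h)) (at (mat 1))"
proof -
  have "invertible (mat 1 :: cmat)"
    unfolding invertible_def by (intro exI[of _ "mat 1"]) simp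
  from has_derivative_compose[OF has_derivative_Pair[OF has_derivative_ident has_derivative_const]
      has_derivative_conj_act[OF this, of x]]
  show ?thesis
    by (simp add: matrix_inv_mat_1)
qed

text \<open>Real-linear injections of \<open>\<complex>\<^sup>4\<close>, \<open>\<complex>\<^sup>4\<close>, \<open>\<complex>\<^sup>8\<close> onto the tangent space of the orbit at
  \<open>e\<close>, the direction space of the slice and \<open>sl\<^sub>3\<close>; \<open>dim\<close> counts real dimensions, \<open>8 + 8 = 16\<close>.\<close>
definition orbit_tangent_coords :: "complex^2^2 \<Rightarrow> cmat" where
  "orbit_tangent_coords x = vector [vector [x$1$1, x$1$2, x$2$1], vector [0, -x$1$1, 0], vector [0, x$2$2, 0]]"

definition slice_direction_coords :: "complex^2^2 \<Rightarrow> cmat" where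
  "slice_direction_coords x =
     vector [vector [x$1$1, 0, 0], vector [x$1$2, x$1$1, x$2$1], vector [x$2$2, 0, -2 * x$1$1]]"

definition sl3_coords :: "complex^2^2^2 \<Rightarrow> cmat" where
  "sl3_coords x = vector [vector [x$1$1$1, x$1$1$2, x$1$2$1], vector [x$1$2$2, x$2$1$1, x$2$1$2],
     vector [x$2$2$1, x$2$2$2, - (x$1$1$1 + x$2$1$1)]]"

lemma linear_inj_coords:
  "linear orbit_tangent_coords" "inj orbit_tangent_coords"
  "linear slice_direction_coords" "inj slice_direction_coords"
  "linear sl3_coords" "inj sl3_coords"
  unfolding linear_iff inj_def orbit_tangent_coords_def slice_direction_coords_def sl3_coords_def
  by (simp_all add: vec_eq_iff forall_2 forall_3 algebra_simps)

lemma range_orbit_tangent_coords: "range (\<lambda>h. h ** e_mat - e_mat ** h) = range orbit_tangent_coords"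
proof (intro equalityI subsetI)
  fix M assume "M \<in> range (\<lambda>h. h ** e_mat - e_mat ** h)"
  then obtain h where "M = h ** e_mat - e_mat ** h"
    by blast
  then have "M = orbit_tangent_coords (vector [vector [- h$2$1, h$1$1 - h$2$2], vector [- h$2$3, h$3$1]])"
    by (simp add: orbit_tangent_coords_def matrix_matrix_mult_def vec_eq_iff forall_3 sum_3
        e_mat_def Emat_def)
  then show "M \<in> range orbit_tangent_coords"
    by blast
next
  fix M assume "M \<in> range orbit_tangent_coords"
  then obtain x where "M = orbit_tangent_coords x"
    by blast
  then have "M = (\<lambda>h. h ** e_mat - e_mat ** h)
      (vector [vector [x$1$2, 0, 0], vector [- x$1$1, 0, - x$2$1], vector [x$2$2, 0, 0]])"
    by (simp add: orbit_tangent_coords_def matrix_matrix_mult_def vec_eq_iff forall_3 sum_3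
        e_mat_def Emat_def)
  then show "M \<in> range (\<lambda>h. h ** e_mat - e_mat ** h)"
    by blast
qed

lemma range_slice_direction_coords: "(\<lambda>v. v - e_mat) ` sC = range slice_direction_coords"
proof (intro equalityI subsetI)
  fix M assume "M \<in> (\<lambda>v. v - e_mat) ` sC"
  then obtain v where "v \<in> sC" "M = v - e_mat"
    by blast
  then have "M = slice_direction_coords (vector [vector [v$1$1, v$2$1], vector [v$2$3, v$3$1]])"
    by (simp add: mem_sC_iff slice_direction_coords_def vec_eq_iff forall_3 e_mat_def Emat_def)
  then show "M \<in> range slice_direction_coords"
    by blast
next
  fix M assume "M \<in> range slice_direction_coords"
  then have "M + e_mat \<in> sC"
    by (auto simp: mem_sC_iff slice_direction_coords_def e_mat_def Emat_def)
  then show "M \<in> (\<lambda>v. v - e_mat) ` sC"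
    by (auto intro: image_eqI[of _ _ "M + e_mat"])
qed

lemma range_sl3_coords: "sl3 = range sl3_coords"
proof (intro equalityI subsetI)
  fix M assume "M \<in> sl3"
  then have "M$3$3 = - (M$1$1 + M$2$2)"
    by (simp add: sl3_def trace_def sum_3 eq_neg_iff_add_eq_0 algebra_simps)
  then have "M = sl3_coords (vector [vector [vector [M$1$1, M$1$2], vector [M$1$3, M$2$1]],
      vector [vector [M$2$2, M$2$3], vector [M$3$1, M$3$2]]])"
    by (simp add: sl3_coords_def vec_eq_iff forall_3)
  then show "M \<in> range sl3_coords"
    by blast
qed (auto simp: sl3_coords_def sl3_def trace_def sum_3)

lemma is_affine_slice_e_mat_sC: "is_affine_slice e_mat sC"
  unfolding is_affine_slice_def
proof (intro conjI ballI)
  show "affine sC" "sC \<subseteq> Xsl3" "e_mat \<in> sC"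
    by (fact affine_sC sC_subset_Xsl3 e_mat_in_sC)+
  show "\<exists>U. open U \<and> sC = U \<inter> closure sC"
    using affine_closed[OF affine_sC] by (intro exI[of _ UNIV]) simp
  fix g s assume "g \<in> GL3" "s \<in> sC"
  then show "\<exists>D. ((\<lambda>p. conj_act (fst p) (snd p)) has_derivative D) (at (g, s)) \<and>
      D ` (UNIV \<times> (\<lambda>v. v - s) ` sC) = sl3"
    using has_derivative_conj_act conj_act_derivative_image unfolding GL3_def by blast
next
  have "dim (range (\<lambda>h. h ** e_mat - e_mat ** h)) + dim ((\<lambda>v. v - e_mat) ` sC) = dim sl3"
    unfolding range_orbit_tangent_coords range_slice_direction_coords range_sl3_coords
    by (simp add: dim_image_eq linear_inj_coords)
  then show "\<exists>Do. ((\<lambda>g. conj_act g e_mat) has_derivative Do) (at (mat 1)) \<and>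
      dim (range Do) + dim ((\<lambda>v. v - e_mat) ` sC) = dim sl3"
    using has_derivative_orbit_map by blast
qed

section \<open>Connectedness of the transporter\<close>

definition mat_of_cols :: "complex^3 \<Rightarrow> complex^3 \<Rightarrow> complex^3 \<Rightarrow> cmat" where
  "mat_of_cols a b c = (\<chi> i j. if j = 1 then a$i else if j = 2 then b$i else c$i)"

lemma mat_of_cols_nth [simp]:
  "mat_of_cols a b c $ i $ 1 = a$i" "mat_of_cols a b c $ i $ 2 = b$i" "mat_of_cols a b c $ i $ 3 = c$i"
  by (simp_all add: mat_of_cols_def)

lemma mat_of_cols_columns: "mat_of_cols (column 1 A) (column 2 A) (column 3 A) = A"
  by (simp add: column_def vec_eq_iff forall_3)

lemma det_mat_of_cols:
  "det (mat_of_cols a b c) = a$1 * b$2 * c$3 + b$1 * c$2 * a$3 + c$1 * a$2 * b$3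
     - a$1 * c$2 * b$3 - b$1 * a$2 * c$3 - c$1 * b$2 * a$3"
  by (simp add: det_3)

lemma matrix_vector_mult_3: "((A::'a::semiring_1^3^'m) *v x) $ i = A$i$1 * x$1 + A$i$2 * x$2 + A$i$3 * x$3"
  by (simp add: matrix_vector_mult_def sum_3)

lemma mat_of_cols_mult_vec: "mat_of_cols a b c *v x = x$1 *s a + x$2 *s b + x$3 *s c"
  by (simp add: vec_eq_iff forall_3 matrix_vector_mult_3 algebra_simps)

lemma continuous_on_mat_of_cols [continuous_intros]:
  assumes "continuous_on S f" "continuous_on S g" "continuous_on S h"
  shows "continuous_on S (\<lambda>x. mat_of_cols (f x) (g x) (h x))"
  unfolding mat_of_cols_def
proof (intro continuous_on_vec_lambda)
  fix i j :: 3
  show "continuous_on S (\<lambda>x. if j = 1 then f x $ i else if j = 2 then g x $ i else h x $ i)"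
    by (cases "j = 1"; cases "j = 2") (simp_all add: continuous_on_component assms)
qed

text \<open>The slice constrains only the last two columns of \<open>K\<^sup>-\<^sup>1 y K\<close>; the trace of \<open>y\<close> fixes its
  \<open>(1,1)\<close> entry.\<close>
lemma conj_act_inverse_in_sC_iff:
  assumes K: "invertible (mat_of_cols k1 v w)" and y: "trace y = 0"
  shows "conj_act (matrix_inv (mat_of_cols k1 v w)) y \<in> sC \<longleftrightarrow>
    (\<exists>a c. y *v v = k1 + a *s v \<and> y *v w = c *s v - (2 * a) *s w)"
proof -
  define K where "K = mat_of_cols k1 v w"
  define M where "M = matrix_inv K ** y ** K"
  have "conj_act (matrix_inv K) y = M"
    using K by (simp add: conj_act_def M_def K_def invertible_matrix_inv)
  have "y ** K = K ** M"
    using K by (simp add: M_def K_def matrix_mul_assoc matrix_inv_inverse)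
  then have yK: "y *v (K *v x) = K *v (M *v x)" for x
    by (simp add: matrix_vector_mul_assoc)
  have "K *v vector [0, 1, 0] = v" "K *v vector [0, 0, 1] = w"
    "M *v vector [0, 1, 0] = vector [M$1$2, M$2$2, M$3$2]"
    "M *v vector [0, 0, 1] = vector [M$1$3, M$2$3, M$3$3]"
    by (simp_all add: K_def mat_of_cols_mult_vec vec_eq_iff forall_3 matrix_vector_mult_3)
  then have yv: "y *v v = K *v vector [M$1$2, M$2$2, M$3$2]"
    and yw: "y *v w = K *v vector [M$1$3, M$2$3, M$3$3]"
    using yK[of "vector [0, 1, 0]"] yK[of "vector [0, 0, 1]"] by simp_all
  have "trace M = 0"
    using K y by (simp add: M_def K_def trace_conj matrix_inv_inverse)
  then have trM: "M$1$1 + M$2$2 + M$3$3 = 0"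
    by (simp add: trace_def sum_3)
  have "k1 + a *s v = K *v vector [1, a, 0]" "c *s v - (2 * a) *s w = K *v vector [0, c, -2 * a]"
    for a c by (simp_all add: K_def mat_of_cols_mult_vec)
  then have "(\<exists>a c. y *v v = k1 + a *s v \<and> y *v w = c *s v - (2 * a) *s w) \<longleftrightarrow>
      (\<exists>a c. vector [M$1$2, M$2$2, M$3$2] = (vector [1, a, 0] :: complex^3)
        \<and> vector [M$1$3, M$2$3, M$3$3] = (vector [0, c, -2 * a] :: complex^3))"
    using K by (simp add: yv yw matrix_vector_mult_cancel K_def)
  also have "\<dots> \<longleftrightarrow> M$1$2 = 1 \<and> M$3$2 = 0 \<and> M$1$3 = 0 \<and> M$3$3 = -2 * M$2$2"
    by (auto simp: vec_eq_iff forall_3)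
  also have "\<dots> \<longleftrightarrow> M \<in> sC"
    using trM unfolding mem_sC_iff by algebra
  finally show ?thesis
    using \<open>conj_act (matrix_inv K) y = M\<close> K_def by simp
qed

text \<open>Inverse to reading off the columns \<open>(k\<^sub>1, v, w)\<close> of \<open>g\<^sup>-\<^sup>1\<close>: \<open>z\<close> is moved along \<open>v\<close> until
  \<open>det (v, w, y w) = 0\<close>, i.e. \<open>y w \<in> span {v, w}\<close>, and then \<open>-2a\<close> is the \<open>w\<close>-coefficient of \<open>y w\<close>.\<close>
definition slice_frame :: "cmat \<Rightarrow> complex^3 \<Rightarrow> complex^3 \<Rightarrow> cmat" where
  "slice_frame y v z =
     (let D = det (mat_of_cols v (y *v v) z);
          w = z + (det (mat_of_cols v z (y *v z)) / D) *s v;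
          a = - det (mat_of_cols v (y *v v) (y *v w)) / (2 * D)
      in mat_of_cols (y *v v - a *s v) v w)"

lemma det_mat_of_cols_combination:
  "det (mat_of_cols a b (x *s a + y *s c + z *s b)) = y * det (mat_of_cols a b c)"
  by (simp add: det_mat_of_cols algebra_simps)

text \<open>Cramer's rule for the coordinates of \<open>u\<close> in the basis \<open>(v, p, w)\<close>.\<close>
lemma in_plane_if_det_eq_0:
  assumes K: "det (mat_of_cols v p w) \<noteq> 0" and u: "det (mat_of_cols v w u) = 0"
  shows "\<exists>c. u = c *s v + (det (mat_of_cols v p u) / det (mat_of_cols v p w)) *s w"
proof -
  define K where "K = mat_of_cols v p w"
  define c where "c = matrix_inv K *v u"
  have "invertible K"
    using K by (simp add: K_def invertible_det_nz)
  then have "u = K *v c"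
    by (metis c_def matrix_vector_mul_assoc matrix_inv_inverse(1) matrix_vector_mul_lid)
  then have u_coords: "u = c$1 *s v + c$3 *s w + c$2 *s p"
    by (simp add: K_def mat_of_cols_mult_vec algebra_simps)
  have "det (mat_of_cols v w u) = - c$2 * det K"
    using det_mat_of_cols_combination[of v w "c$1" "c$2" p "c$3"]
    unfolding u_coords K_def by (simp add: det_mat_of_cols algebra_simps)
  then have "c$2 = 0"
    using u K by (simp add: K_def)
  moreover have "det (mat_of_cols v p u) = c$3 * det K"
    using det_mat_of_cols_combination[of v p "c$1" "c$3" w "c$2"]
    unfolding u_coords K_def by (simp add: algebra_simps)
  ultimately show ?thesis
    using u_coords K by (intro exI[of _ "c$1"]) (simp add: K_def)
qed

lemma slice_frame_conj_in_sC:
  assumes y: "trace y = 0" and D: "det (mat_of_cols v (y *v v) z) \<noteq> 0"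
  shows "invertible (slice_frame y v z)" and "conj_act (matrix_inv (slice_frame y v z)) y \<in> sC"
proof -
  define D where "D = det (mat_of_cols v (y *v v) z)"
  define t where "t = det (mat_of_cols v z (y *v z)) / D"
  define w where "w = z + t *s v"
  define a where "a = - det (mat_of_cols v (y *v v) (y *v w)) / (2 * D)"
  have frame: "slice_frame y v z = mat_of_cols (y *v v - a *s v) v w"
    by (simp add: slice_frame_def Let_def D_def t_def w_def a_def)
  have "D \<noteq> 0"
    using assms by (simp add: D_def)
  have detK: "det (mat_of_cols v (y *v v) w) = D"
    by (simp add: w_def D_def det_mat_of_cols algebra_simps)
  have "det (slice_frame y v z) = - D"
    by (simp add: frame detK[symmetric] det_mat_of_cols algebra_simps)
  then show "invertible (slice_frame y v z)"
    using \<open>D \<noteq> 0\<close> by (simp add: invertible_det_nz)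
  have yw: "y *v w = y *v z + t *s (y *v v)"
    by (simp add: w_def matrix_vector_right_distrib vector_scalar_commute)
  have "det (mat_of_cols v w (y *v w)) = det (mat_of_cols v z (y *v z)) - t * D"
    unfolding yw by (simp add: w_def D_def det_mat_of_cols algebra_simps)
  then have "det (mat_of_cols v w (y *v w)) = 0"
    using \<open>D \<noteq> 0\<close> by (simp add: t_def)
  then obtain c where "y *v w = c *s v + (- 2 * a) *s w"
    using in_plane_if_det_eq_0[of v "y *v v" w "y *v w"] detK \<open>D \<noteq> 0\<close> by (auto simp: a_def)
  then have "y *v w = c *s v - (2 * a) *s w"
    by (simp add: algebra_simps)
  moreover have "y *v v = (y *v v - a *s v) + a *s v"
    by simp
  ultimately show "conj_act (matrix_inv (slice_frame y v z)) y \<in> sC"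
    using conj_act_inverse_in_sC_iff \<open>invertible (slice_frame y v z)\<close> y unfolding frame by blast
qed

lemma slice_frame_surj:
  assumes g: "invertible g" and y: "trace y = 0" and gy: "conj_act g y \<in> sC"
  shows "\<exists>v z. det (mat_of_cols v (y *v v) z) \<noteq> 0 \<and> slice_frame y v z = matrix_inv g"
proof -
  define k1 v z where "k1 = column 1 (matrix_inv g)" and "v = column 2 (matrix_inv g)"
    and "z = column 3 (matrix_inv g)"
  have k: "matrix_inv g = mat_of_cols k1 v z"
    by (simp add: k1_def v_def z_def mat_of_cols_columns)
  have "invertible (mat_of_cols k1 v z)" and "matrix_inv (mat_of_cols k1 v z) = g"
    using invertible_matrix_inv[OF g] unfolding k by simp_all
  then obtain a c where yv: "y *v v = k1 + a *s v" and yz: "y *v z = c *s v - (2 * a) *s z"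
    using conj_act_inverse_in_sC_iff[of k1 v z y] y gy by auto
  have "det (mat_of_cols v (y *v v) z) = - det (matrix_inv g)"
    by (simp add: k yv det_mat_of_cols algebra_simps)
  then have D: "det (mat_of_cols v (y *v v) z) \<noteq> 0"
    using invertible_matrix_inv[OF g] invertible_det_nz by auto
  have "det (mat_of_cols v z (y *v z)) = 0"
    by (simp add: yz det_mat_of_cols algebra_simps)
  moreover have "det (mat_of_cols v (y *v v) (y *v z)) = - 2 * a * det (mat_of_cols v (y *v v) z)"
    by (simp add: yz det_mat_of_cols algebra_simps)
  ultimately have "slice_frame y v z = mat_of_cols k1 v z"
    using D by (simp add: slice_frame_def Let_def yv)
  with D k show ?thesis
    by auto
qed

definition frame_domain :: "cmat \<Rightarrow> ((complex^3) \<times> (complex^3)) set" where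
  "frame_domain y = {(v, z). det (mat_of_cols v (y *v v) z) \<noteq> 0}"

lemma continuous_on_slice_frame:
  "continuous_on (frame_domain y) (\<lambda>(v, z). slice_frame y v z)"
  unfolding slice_frame_def Let_def frame_domain_def case_prod_beta
  by (intro continuous_intros) auto

lemma transporter_eq_frame_image:
  assumes "y \<in> sC"
  shows "{g \<in> GL3. conj_act g y \<in> sC} = (\<lambda>(v, z). matrix_inv (slice_frame y v z)) ` frame_domain y"
proof (intro equalityI subsetI)
  fix g assume "g \<in> {g \<in> GL3. conj_act g y \<in> sC}"
  then have "invertible g" "conj_act g y \<in> sC"
    by (simp_all add: GL3_def)
  then obtain v z where "(v, z) \<in> frame_domain y" "slice_frame y v z = matrix_inv g"
    using slice_frame_surj trace_sC[OF assms] unfolding frame_domain_def by blast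
  then show "g \<in> (\<lambda>(v, z). matrix_inv (slice_frame y v z)) ` frame_domain y"
    using invertible_matrix_inv(2)[OF \<open>invertible g\<close>] by force
next
  fix g assume "g \<in> (\<lambda>(v, z). matrix_inv (slice_frame y v z)) ` frame_domain y"
  then obtain v z where "det (mat_of_cols v (y *v v) z) \<noteq> 0" "g = matrix_inv (slice_frame y v z)"
    by (auto simp: frame_domain_def)
  then have "invertible (slice_frame y v z)" and "conj_act g y \<in> sC"
    using slice_frame_conj_in_sC[OF trace_sC[OF assms]] by blast+
  then show "g \<in> {g \<in> GL3. conj_act g y \<in> sC}"
    using \<open>g = matrix_inv (slice_frame y v z)\<close> invertible_matrix_inv(1) by (simp add: GL3_def)
qed

lemma connected_frame_domain:
  assumes "y \<in> sC"
  shows "connected (frame_domain y)"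
proof -
  define x0 :: "(complex^3) \<times> (complex^3)" where "x0 = (vector [0, 1, 0], vector [0, 0, 1])"
  have "connected {p. det (mat_of_cols (fst p) (y *v fst p) (snd p)) \<noteq> 0}"
  proof (rule connected_nonzero_set_if_polynomial_on_lines[where a = x0])
    show "det (mat_of_cols (fst x0) (y *v fst x0) (snd x0)) \<noteq> 0"
      using assms by (simp add: x0_def mem_sC_iff det_mat_of_cols matrix_vector_mult_3)
  next
    fix p :: "(complex^3) \<times> (complex^3)"
    define \<gamma> where "\<gamma> t = (fst x0 + t *s (fst p - fst x0), snd x0 + t *s (snd p - snd x0))" for t
    have "continuous_on UNIV \<gamma>"
      unfolding \<gamma>_def by (intro continuous_intros)
    moreover have "\<gamma> 0 = x0" "\<gamma> 1 = p"
      by (simp_all add: \<gamma>_def prod_eq_iff)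
    moreover have "is_polynomial (\<lambda>t. det (mat_of_cols (fst (\<gamma> t)) (y *v fst (\<gamma> t)) (snd (\<gamma> t))))"
      unfolding \<gamma>_def
      by (simp only: det_mat_of_cols matrix_vector_mult_3 vector_add_component vector_minus_component
          vector_smult_component fst_conv snd_conv) (intro is_polynomial_intros)
    ultimately show "\<exists>\<gamma>. continuous_on UNIV \<gamma> \<and> \<gamma> 0 = x0 \<and> \<gamma> 1 = p \<and>
        is_polynomial (\<lambda>t. det (mat_of_cols (fst (\<gamma> t)) (y *v fst (\<gamma> t)) (snd (\<gamma> t))))"
      by blast
  qed
  then show ?thesis
    by (simp add: frame_domain_def split_def)
qed

lemma connected_transporter:
  assumes "y \<in> sC"
  shows "connected {g \<in> GL3. conj_act g y \<in> sC}"
  unfolding transporter_eq_frame_image[OF assms]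
proof (rule connected_continuous_image[OF _ connected_frame_domain[OF assms]])
  have "(\<lambda>(v, z). slice_frame y v z) ` frame_domain y \<subseteq> {A. invertible A}"
    using slice_frame_conj_in_sC(1)[OF trace_sC[OF assms]] by (auto simp: frame_domain_def)
  then show "continuous_on (frame_domain y) (\<lambda>(v, z). matrix_inv (slice_frame y v z))"
    using continuous_on_compose2[OF continuous_on_matrix_inv continuous_on_slice_frame]
    by (simp add: case_prod_beta')
qed

theorem lemma7p3:
  shows "sC = {vector [vector [a, 1, 0], vector [b, a, c], vector [d, 0, -2 * a]] | a b c d. True}
     \<and> is_affine_slice e_mat sC
     \<and> (\<forall>y\<in>sC. connected {g \<in> GL3. conj_act g y \<in> sC})"
  using sC_eq_matrices is_affine_slice_e_mat_sC connected_transporter by blast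

end
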